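(* For $k=3$ or $k=-1$ and integers $a,d\ge2$, the first nonzero coefficient of $W_{a,d}(q,k)-T(q)$ modulo two is one and occurs at order $$\begin{cases}3a(d-1)+2,&d\text{ odd},\\ a(3d-4)+4,&d\text{ even}.\end{cases}$$ In particular, $$W_{2,d}(q,k)-T(q)\equiv q^{6d-4}+O(q^{6d-3})\pmod2\qquad(\text{with } a=2 \text{ in } T).$$
   Context: $\Phi(q)=\prod_{n\ge1}(1-q^n)$; for every integer $k$, $F(q)=\Phi(q)^k\in\mathbb Z[[q]]$. Define $C_m(q)\in\mathbb Z[[q]]$ by $$\frac{\sum_{m\ge0}X^mF(q^{am+1})}{\sum_{m\ge0}X^mF(q^{a(m+1)})}=\sum_{m\ge0}C_m(q)X^m\quad\text{in }\mathbb Z[[q]][[X]],$$ and the formal Laurent series in $q^{1-a}\mathbb Z[[q]]$ $$W_{a,d}(q,k)=q^{1-a}\sum_{j\ge0}C_{jd}(q)q^{ajd},\qquad T(q)=q^{1-a}\frac{\Phi(q)^k}{\Phi(q^a)^k}.$$ $O(q^n)$ means divisible by $q^n$. *)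

theory Defs
  imports "HOL-Analysis.Analysis" "HOL-Computational_Algebra.Computational_Algebra"
    "HOL-Number_Theory.Cong"
begin

text \<open>
  The formal variable \<open>q\<close> is \<^term>\<open>fps_X\<close>. Infinite sums and products of
  power series are taken in the library's metric topology on formal power series; for integer
  coefficients this is coefficientwise stabilisation.
\<close>

definition Phi :: "int fps" where
  "Phi = (\<Prod>n. 1 - fps_X ^ Suc n)"

text \<open>
  \<^typ>\<open>int\<close> has no multiplicative inverse operation, so \<^const>\<open>inverse\<close> is not available on
  \<^typ>\<open>int fps\<close>. This is the inverse in \<open>\<int>[[q]]\<close> of a series with constant coefficient 1
  (lemma \<open>recip1_right\<close>); no meaning is intended for other series.
\<close>

definition recip1 :: "int fps \<Rightarrow> int fps" where
  "recip1 f = fps_right_inverse f 1"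

definition ipow :: "int fps \<Rightarrow> int \<Rightarrow> int fps" where
  "ipow f k = (if 0 \<le> k then f ^ nat k else recip1 f ^ nat (- k))"

text \<open>The substitution \<open>f(q\<^sup>n)\<close>, for \<open>n \<ge> 1\<close>.\<close>

definition subst_pow :: "int fps \<Rightarrow> nat \<Rightarrow> int fps" where
  "subst_pow f n = fps_compose f (fps_X ^ n)"

definition F :: "int \<Rightarrow> int fps" where
  "F k = ipow Phi k"

text \<open>
  Elements of \<open>\<int>[[q]][[X]]\<close> have type \<^typ>\<open>int fps fps\<close>: the outer index is the power of \<open>X\<close>.
  The denominator is invertible because its \<open>X\<^sup>0\<close>-coefficient \<open>F(q\<^sup>a)\<close> is a unit of
  \<open>\<int>[[q]]\<close>; see \<open>Cgen_times_Cden\<close>.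
\<close>

definition Cnum :: "nat \<Rightarrow> int \<Rightarrow> int fps fps" where
  "Cnum a k = Abs_fps (\<lambda>m. subst_pow (F k) (a * m + 1))"

definition Cden :: "nat \<Rightarrow> int \<Rightarrow> int fps fps" where
  "Cden a k = Abs_fps (\<lambda>m. subst_pow (F k) (a * (m + 1)))"

definition Cgen :: "nat \<Rightarrow> int \<Rightarrow> int fps fps" where
  "Cgen a k = Cnum a k * fps_right_inverse (Cden a k) (recip1 (subst_pow (F k) a))"

definition C :: "nat \<Rightarrow> int \<Rightarrow> nat \<Rightarrow> int fps" where
  "C a k m = fps_nth (Cgen a k) m"

definition W :: "nat \<Rightarrow> nat \<Rightarrow> int \<Rightarrow> int fls" where
  "W a d k = fls_X_intpow (1 - int a) *
     fps_to_fls (\<Sum>j. C a k (j * d) * fps_X ^ (a * j * d))"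

definition T :: "nat \<Rightarrow> int \<Rightarrow> int fls" where
  "T a k = fls_X_intpow (1 - int a) *
     fps_to_fls (ipow Phi k * recip1 (ipow (subst_pow Phi a) k))"

definition cong_mod2 :: "int fls \<Rightarrow> int fls \<Rightarrow> bool" where
  "cong_mod2 f g \<longleftrightarrow> (\<forall>n. [fls_nth f n = fls_nth g n] (mod 2))"

text \<open>
  Divisibility by \<open>q\<^sup>n\<close> has its cofactor in \<open>\<int>[[q]]\<close>: among Laurent series \<open>q\<^sup>n\<close> is a unit,
  so \<^const>\<open>dvd\<close> on \<^typ>\<open>int fls\<close> would be vacuous.
\<close>

definition bigO_q :: "int \<Rightarrow> int fls \<Rightarrow> bool" where
  "bigO_q n f \<longleftrightarrow> (\<exists>h :: int fps. f = fls_X_intpow n * fps_to_fls h)"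


text \<open>The infinite product, the quotients and the infinite sum above are all proper.\<close>

lemma Phi_has_prod: "(\<lambda>n. 1 - fps_X ^ Suc n :: int fps) has_prod Phi"
  and Phi_nth_0: "fps_nth Phi 0 = 1"
proof -
  define P :: "nat \<Rightarrow> int fps" where "P n = (\<Prod>i\<le>n. 1 - fps_X ^ Suc i)" for n
  define L where "L = Abs_fps (\<lambda>j. fps_nth (P j) j)"
  have step: "fps_nth (P (Suc n)) j = fps_nth (P n) j" if "j \<le> n" for n j
  proof -
    have "P (Suc n) = P n - P n * fps_X ^ Suc (Suc n)"
      by (simp add: P_def algebra_simps)
    then show ?thesis
      using that by (simp add: fps_X_power_mult_right_nth del: power_Suc)
  qed
  have stab: "fps_nth (P n) j = fps_nth (P j) j" if "j \<le> n" for n j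
    using that by (induction n rule: dec_induct) (simp_all add: step)
  have "P \<longlonglongrightarrow> L"
    by (rule tendsto_fpsI)
      (auto simp: L_def eventually_sequentially intro: stab)
  moreover have L0: "fps_nth L 0 = 1"
    by (simp add: L_def P_def)
  ultimately have *: "(\<lambda>n. 1 - fps_X ^ Suc n :: int fps) has_prod L"
    unfolding has_prod_def raw_has_prod_def P_def by auto
  have nz: "(1 - fps_X ^ Suc i :: int fps) \<noteq> 0" for i
  proof
    assume "(1 - fps_X ^ Suc i :: int fps) = 0"
    then have "fps_nth (1 - fps_X ^ Suc i :: int fps) 0 = 0"
      by simp
    then show False by simp
  qed
  have "Phi = L"
    unfolding Phi_def prodinf_def
  proof (rule the_equality, rule *)
    fix p :: "int fps" assume "(\<lambda>n. 1 - fps_X ^ Suc n :: int fps) has_prod p"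
    then have "P \<longlonglongrightarrow> p"
      unfolding has_prod_def raw_has_prod_def P_def using nz by auto
    from this \<open>P \<longlonglongrightarrow> L\<close> show "p = L"
      by (rule LIMSEQ_unique)
  qed
  with * L0 show "(\<lambda>n. 1 - fps_X ^ Suc n :: int fps) has_prod Phi" "fps_nth Phi 0 = 1"
    by simp_all
qed

lemma recip1_right: "fps_nth f 0 = 1 \<Longrightarrow> f * recip1 f = 1"
  unfolding recip1_def by (rule fps_right_inverse) simp

lemma recip1_nth_0: "fps_nth (recip1 f) 0 = 1"
  by (simp add: recip1_def)

lemma ipow_nth_0: "fps_nth f 0 = 1 \<Longrightarrow> fps_nth (ipow f k) 0 = 1"
  by (simp add: ipow_def recip1_nth_0 fps_power_zeroth)

lemma subst_pow_nth_0: "fps_nth (subst_pow f n) 0 = fps_nth f 0"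
  by (simp add: subst_pow_def fps_compose_nth)

lemma F_nth_0: "fps_nth (F k) 0 = 1"
  by (simp add: F_def ipow_nth_0 Phi_nth_0)

lemma Cgen_times_Cden: "Cgen a k * Cden a k = Cnum a k"
proof -
  have "Cden a k * fps_right_inverse (Cden a k) (recip1 (subst_pow (F k) a)) = 1"
    by (rule fps_right_inverse)
      (simp add: Cden_def recip1_right subst_pow_nth_0 F_nth_0)
  then show ?thesis
    unfolding Cgen_def by (metis mult.assoc mult.commute mult_1_right)
qed

lemma W_summable:
  assumes "a \<ge> 1" "d \<ge> 1"
  shows "summable (\<lambda>j. C a k (j * d) * fps_X ^ (a * j * d))"
proof -
  define S where "S n = (\<Sum>j<n. C a k (j * d) * fps_X ^ (a * j * d))" for n
  have "fps_nth (S n) i = fps_nth (S (Suc i)) i" if "Suc i \<le> n" for n i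
    using that
  proof (induction n rule: dec_induct)
    case (step n)
    have "1 * n * 1 \<le> a * n * d"
      using assms by (intro mult_le_mono) auto
    with step.hyps have "i < a * n * d" by linarith
    then have "fps_nth (S (Suc n)) i = fps_nth (S n) i"
      by (simp add: S_def fps_X_power_mult_right_nth)
    with step.IH show ?case by simp
  qed simp
  then have "\<forall>\<^sub>F n in sequentially. fps_nth (S n) i = fps_nth (Abs_fps (\<lambda>i. fps_nth (S (Suc i)) i)) i" for i
    unfolding eventually_sequentially fps_nth_Abs_fps by blast
  then have "S \<longlonglongrightarrow> Abs_fps (\<lambda>i. fps_nth (S (Suc i)) i)"
    by (rule tendsto_fpsI)
  then show ?thesis
    unfolding summable_def sums_def S_def by blast
qed

end

theory Submission
  imports Defs "HOL-Library.Z2"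
begin

text \<open>
  Modulo two, \<open>F(q) = 1 + q + q\<^sup>3 + O(q\<^sup>4)\<close> both for \<open>k = 3\<close> and for \<open>k = -1\<close>, and
  nothing else about \<open>F\<close> matters. Put \<open>x = q\<^sup>a\<close>. Multiplying numerator and
  denominator of the defining quotient by \<open>(1 + X)(1 + x X)\<close> removes the contributions of the terms
  \<open>1\<close> and \<open>q\<close> of \<open>F\<close> to all coefficients from \<open>X\<^sup>2\<close> on, so that the term \<open>q\<^sup>3\<close> dominates. After the rescaling
  \<open>X = Y / x\<^sup>2\<close> the denominator becomes \<open>1 + Y\<^sup>2 + O(x)\<close>, while \<open>q\<^bsup>3a-3\<^esup>\<close> times the
  numerator becomes \<open>q\<^bsup>a-2\<^esup> u\<^sub>1 Y + u\<^sub>2 Y\<^sup>2 + O(x)\<close> with units \<open>u\<^sub>1\<close>, \<open>u\<^sub>2\<close>. The quotient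
  is therefore 2-periodic in the exponent of \<open>Y\<close> modulo \<open>x\<close>, which gives the exact order of every \<open>C\<^sub>m\<close>
  with \<open>m \<ge> 1\<close>. Since \<open>T\<close> is the summand \<open>j = 0\<close> of \<open>W\<close>, the summand \<open>j = 1\<close>
  decides the first coefficient of \<open>W - T\<close>.
\<close>

section \<open>Clearing the terms 1 and q of F from numerator and denominator\<close>

text \<open>The weights \<open>1\<close>, \<open>1 + x\<close>, \<open>x\<close> are the
  coefficients of (1 + X)(1 + x X). In characteristic 2 the corresponding recurrence kills geometric
  sequences of ratio 1 and x, so the constant and linear terms in \<open>w\<close> cancel and the
  cubic ones lead.\<close>

lemma char2_window:
  fixes x w g1 g2 g3 :: "'a :: idom"
  assumes "(2 :: 'a) = 0"
  shows "(1 + x^2*w + (x^2*w)^3 + (x^2*w)^4*g3) + (1 + x)*(1 + x*w + (x*w)^3 + (x*w)^4*g2)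
      + x*(1 + w + w^3 + w^4*g1)
    = w^3*x*(1 + x^2 + x^3 + x^5) + w^4*x*(x^7*g3 + (1 + x)*x^3*g2 + g1)"
    (is "?l = ?r")
proof -
  have "?l = ?r + 2 * (1 + x + (x^2 + x) * w)"
    by algebra
  then show ?thesis using assms by simp
qed

lemma fps_mult_quadratic_nth:
  fixes D :: "'a :: comm_ring_1 fps" and u v :: 'a
  defines "P \<equiv> 1 + fps_const u * fps_X + fps_const v * fps_X ^ 2"
  shows "fps_nth (D * P) 0 = fps_nth D 0"
    and "fps_nth (D * P) (Suc 0) = fps_nth D (Suc 0) + u * fps_nth D 0"
    and "fps_nth (D * P) (Suc (Suc n)) = fps_nth D (Suc (Suc n)) + u * fps_nth D (Suc n) + v * fps_nth D n"
proof -
  have "D * P = D + fps_const u * (D * fps_X) + fps_const v * (D * fps_X * fps_X)"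
    by (simp add: P_def algebra_simps power2_eq_square)
  then show "fps_nth (D * P) 0 = fps_nth D 0"
    and "fps_nth (D * P) (Suc 0) = fps_nth D (Suc 0) + u * fps_nth D 0"
    and "fps_nth (D * P) (Suc (Suc n)) = fps_nth D (Suc (Suc n)) + u * fps_nth D (Suc n) + v * fps_nth D n"
    by simp_all
qed

text \<open>Here \<open>f s\<close> stands for F(q^s) with unspecified tail \<open>G s\<close>, and
  the factor \<open>x ^ (2 * m)\<close> is what the rescaling X = Y / x^2 absorbs. For m = n + 2 the
  window at w = x^(n+1) leads with w^3 x = x^(2m) x^n, which is exactly x^(2m) only for n = 0; hence
  the 1 at m = 2.\<close>

lemma denominator_window:
  fixes f G :: "nat \<Rightarrow> 'a :: field fps"
  assumes two: "(2 :: 'a fps) = 0"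
    and f: "\<And>s. s > 0 \<Longrightarrow> f s = 1 + fps_X ^ s + fps_X ^ (3 * s) + fps_X ^ (4 * s) * G s"
    and a: "a \<ge> 2"
  defines "x \<equiv> fps_X ^ a"
  shows "\<exists>e. fps_nth (Abs_fps (\<lambda>m. f (a * (m + 1))) * (1 + fps_const (1 + x) * fps_X + fps_const x * fps_X ^ 2)) m
    = x ^ (2 * m) * ((if m = 0 \<or> m = 2 then 1 else 0) + x * e)"
proof -
  have fx: "f (a * i) = 1 + x ^ i + x ^ (3*i) + x ^ (4*i) * G (a*i)" if "i > 0" for i
    using f[of "a * i"] that a by (simp add: x_def mult_ac flip: power_mult)
  consider "m = 0" | "m = Suc 0" | n where "m = Suc (Suc n)"
    by (metis not0_implies_Suc)
  then show ?thesis
  proof cases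
    case 1
    have "f a = 1 + x * (1 + x^2 + x^3 * G a)"
      using fx[of 1] by (simp add: algebra_simps power3_eq_cube power2_eq_square numeral_eq_Suc)
    then show ?thesis
      by (auto simp: 1 fps_mult_quadratic_nth)
  next
    case 2
    have f2: "f (a + a) = 1 + x^2 + x^6 + x^8 * G (a + a)"
      using fx[of 2] by (simp add: mult_2_right)
    have f1: "f a = 1 + x + x^3 + x^4 * G a"
      using fx[of 1] by simp
    \<comment> \<open>Only two values enter here, but the terms 1, x and x^2 still pair off; order
      x^3 is left, one more than x^(2m).\<close>
    have "f (a + a) + (1 + x) * f a
        = x^2 * (x * (1 + x + x^3 + x * (1 + x) * G a + x^5 * G (a + a))) + 2 * (1 + x + x^2)"
      unfolding f1 f2 by algebra
    then have "f (a + a) + (1 + x) * f a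
        = x^2 * (x * (1 + x + x^3 + x * (1 + x) * G a + x^5 * G (a + a)))"
      by (simp add: two)
    moreover have "fps_nth (Abs_fps (\<lambda>m. f (a * (m + 1)))
        * (1 + fps_const (1 + x) * fps_X + fps_const x * fps_X ^ 2)) m = f (a + a) + (1 + x) * f a"
      unfolding 2 fps_mult_quadratic_nth by simp
    ultimately show ?thesis
      by (auto simp: 2 numeral_eq_Suc)
  next
    case (3 n)
    define w where "w = x ^ (n + 1)"
    define H where "H = x^7 * G (a * (n + 3)) + (1 + x) * x^3 * G (a * (n + 2)) + G (a * (n + 1))"
    have s: "f (a * (n + 1)) = 1 + w + w^3 + w^4 * G (a * (n + 1))"
      "f (a * (n + 2)) = 1 + x*w + (x*w)^3 + (x*w)^4 * G (a * (n + 2))"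
      "f (a * (n + 3)) = 1 + x^2*w + (x^2*w)^3 + (x^2*w)^4 * G (a * (n + 3))"
      by (subst fx, simp, simp add: w_def algebra_simps numeral_3_eq_3 flip: power_mult power_add power_Suc)+
    have "f (a * (n + 3)) + (1 + x) * f (a * (n + 2)) + x * f (a * (n + 1))
        = w^3*x*(1 + x^2 + x^3 + x^5) + w^4*x*H"
      unfolding s H_def by (rule char2_window[OF two])
    also have "\<dots> = x ^ (2*m) * (x^n * (1 + x * (x + x^2 + x^4)) + x * ((x^n)^2 * H))"
    proof -
      have "x ^ (2*m) = x^4 * (x^n)^2"
        unfolding 3 power_even_eq power_Suc by algebra
      show ?thesis
        unfolding \<open>x ^ (2*m) = _\<close> w_def power_add power_one_right by algebra
    qed
    finally have sum_eq: "f (a * (n + 3)) + (1 + x) * f (a * (n + 2)) + x * f (a * (n + 1))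
        = x ^ (2*m) * (x^n * (1 + x * (x + x^2 + x^4)) + x * ((x^n)^2 * H))" .
    have "\<exists>e. x^n * (1 + x * (x + x^2 + x^4)) + x * ((x^n)^2 * H) = (if m = 0 \<or> m = 2 then 1 else 0) + x * e"
    proof (cases n)
      case 0
      then show ?thesis by (auto simp: 3 algebra_simps intro!: exI[of _ "x + x^2 + x^4 + (x^n)^2 * H"])
    next
      case (Suc l)
      then show ?thesis
        by (auto simp: 3 algebra_simps intro!: exI[of _ "x^l * (1 + x * (x + x^2 + x^4)) + (x^n)^2 * H"])
    qed
    moreover have "fps_nth (Abs_fps (\<lambda>m. f (a * (m + 1)))
        * (1 + fps_const (1 + x) * fps_X + fps_const x * fps_X ^ 2)) m
      = f (a * (n + 3)) + (1 + x) * f (a * (n + 2)) + x * f (a * (n + 1))"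
      unfolding 3 fps_mult_quadratic_nth by (simp add: numeral_eq_Suc)
    ultimately show ?thesis
      unfolding sum_eq by metis
  qed
qed


text \<open>The arguments a n + 1 put w = q x^n into the window, whose leading term w^3 x carries
  q^3. The prefactor q^(3a-3) completes this to x^3, so the rescaling of the denominator fits the
  numerator too. At m = 1 only two values enter and the sum leads with q instead, which gives
  q^(3a-2) = x^2 q^(a-2).\<close>

lemma numerator_window:
  fixes f G :: "nat \<Rightarrow> 'a :: field fps"
  assumes two: "(2 :: 'a fps) = 0"
    and f: "\<And>s. s > 0 \<Longrightarrow> f s = 1 + fps_X ^ s + fps_X ^ (3 * s) + fps_X ^ (4 * s) * G s"
    and a: "a \<ge> 2"
  defines "x \<equiv> fps_X ^ a"
  shows "\<exists>r. fps_X ^ (3 * a - 3) * fps_nth (Abs_fps (\<lambda>m. f (a * m + 1))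
        * (1 + fps_const (1 + x) * fps_X + fps_const x * fps_X ^ 2)) m = x ^ (2 * m) * r
      \<and> (m = 1 \<longrightarrow> (\<exists>u. r = fps_X ^ (a - 2) * u \<and> fps_nth u 0 = 1))
      \<and> (m = 2 \<longrightarrow> fps_nth r 0 = 1) \<and> (m \<noteq> 1 \<longrightarrow> m \<noteq> 2 \<longrightarrow> x dvd r)"
proof -
  define p :: "'a fps" where "p = fps_X ^ (3 * a - 3)"
  have px: "p * fps_X ^ 3 = x ^ 3"
    using a by (simp add: p_def x_def mult.commute flip: power_add power_mult)
  have f': "f s = 1 + w + w^3 + w^4 * G s" if "s > 0" "w = fps_X ^ s" for s w
    using f[OF that(1)] that(2) by (simp add: mult.commute flip: power_mult)
  consider "m = 0" | "m = Suc 0" | n where "m = Suc (Suc n)"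
    by (metis not0_implies_Suc)
  then show ?thesis
  proof cases
    case 1
    have "p = x * fps_X ^ (2 * a - 3)"
      using a by (simp add: p_def x_def flip: power_add)
    then show ?thesis
      by (simp add: 1 fps_mult_quadratic_nth flip: p_def)
  next
    case 2
    define q :: "'a fps" where "q = fps_X"
    define y where "y = q ^ (a - 2)"
    have x: "x = q^2 * y"
      unfolding x_def q_def y_def power_add[symmetric] le_add_diff_inverse[OF a] ..
    \<comment> \<open>\<open>u\<close> is the sum below divided by q, with the even terms dropped.
      Writing x = q^2 y makes the lone x from \<open>(1 + x) * f 1\<close> divisible by q as
      well.\<close>
    define u where "u = 1 + q^2 + q^3 * G 1 + q * y * (1 + q^3 + q^4 * G 1
      + x^2 * q^3 + x^3 * q^4 * G (a + 1))"
    have s: "f (a + 1) = 1 + x * q + (x * q)^3 + (x * q)^4 * G (a + 1)"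
      "f 1 = 1 + q + q^3 + q^4 * G 1"
      by (rule f'; simp add: x_def q_def)+
    have "f (a + 1) + (1 + x) * f 1 = q * u + 2 * (1 + x * q)"
      unfolding s u_def x by algebra
    then have "f (a + 1) + (1 + x) * f 1 = q * u"
      by (simp add: two)
    moreover have u0: "fps_nth u 0 = 1"
      by (simp add: u_def q_def)
    moreover have pq: "p * q = x ^ 2 * y"
      using a by (simp add: p_def q_def y_def x_def mult.commute flip: power_add power_mult power_Suc)
    ultimately have "p * (f (a + 1) + (1 + x) * f 1) = x ^ 2 * (y * u)"
      by (simp only: flip: mult.assoc)
    moreover have nth: "fps_nth (Abs_fps (\<lambda>m. f (a * m + 1))
        * (1 + fps_const (1 + x) * fps_X + fps_const x * fps_X ^ 2)) m = f (a + 1) + (1 + x) * f 1"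
      unfolding 2 fps_mult_quadratic_nth by simp
    ultimately show ?thesis
      unfolding nth p_def y_def q_def
      by (intro exI[of _ "fps_X ^ (a - 2) * u"]) (auto simp: 2 numeral_eq_Suc u0)
  next
    case (3 n)
    define w where "w = fps_X * x ^ n"
    define H where "H = x^7 * G (a * (n + 2) + 1) + (1 + x) * x^3 * G (a * (n + 1) + 1) + G (a * n + 1)"
    have s: "f (a * n + 1) = 1 + w + w^3 + w^4 * G (a * n + 1)"
      "f (a * (n + 1) + 1) = 1 + x*w + (x*w)^3 + (x*w)^4 * G (a * (n + 1) + 1)"
      "f (a * (n + 2) + 1) = 1 + x^2*w + (x^2*w)^3 + (x^2*w)^4 * G (a * (n + 2) + 1)"
      by (rule f'; simp add: w_def x_def algebra_simps power2_eq_square flip: power_mult power_add power_Suc)+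
    define r where "r = x^n * (1 + x^2 + x^3 + x^5 + w * H)"
    have "f (a * (n + 2) + 1) + (1 + x) * f (a * (n + 1) + 1) + x * f (a * n + 1)
        = w^3*x*(1 + x^2 + x^3 + x^5) + w^4*x*H"
      unfolding s H_def by (rule char2_window[OF two])
    also have "p * \<dots> = (p * fps_X ^ 3) * (x * (x ^ n) ^ 3 * (1 + x^2 + x^3 + x^5 + w * H))"
      unfolding w_def by algebra
    also have "\<dots> = x ^ (2 * m) * r"
      unfolding px r_def 3 power_even_eq power_Suc by algebra
    finally have "p * (f (a * (n + 2) + 1) + (1 + x) * f (a * (n + 1) + 1) + x * f (a * n + 1))
      = x ^ (2 * m) * r" .
    moreover have "fps_nth r 0 = 1" if "n = 0"
      using a that by (simp add: r_def w_def x_def fps_power_zeroth power_0_left)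
    moreover have "x dvd r" if "n \<noteq> 0"
      using that by (simp add: r_def dvd_power)
    moreover have nth: "fps_nth (Abs_fps (\<lambda>m. f (a * m + 1))
        * (1 + fps_const (1 + x) * fps_X + fps_const x * fps_X ^ 2)) m
      = f (a * (n + 2) + 1) + (1 + x) * f (a * (n + 1) + 1) + x * f (a * n + 1)"
      unfolding 3 fps_mult_quadratic_nth by simp
    ultimately show ?thesis
      unfolding nth p_def by (intro exI[of _ r]) (auto simp: 3)
  qed
qed


section \<open>Order of the coefficients of the quotient\<close>

text \<open>After clearing and rescaling, the coefficients of the quotient from index 1 on are
  2-periodic modulo x, with values of order a - 2 at odd and 0 at even indices. Both orders are
  below a, hence exact. Undoing the scaling multiplies by x^(2m) / q^(3a-3), which yields the two
  exponents.\<close>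

lemma char2_quotient_coefficient:
  fixes f G :: "nat \<Rightarrow> 'a :: field fps" and c :: "'a fps fps"
  assumes two: "(2 :: 'a fps) = 0"
    and f: "\<And>s. s > 0 \<Longrightarrow> f s = 1 + fps_X ^ s + fps_X ^ (3 * s) + fps_X ^ (4 * s) * G s"
    and a: "a \<ge> 2"
    and c: "c * Abs_fps (\<lambda>m. f (a * (m + 1))) = Abs_fps (\<lambda>m. f (a * m + 1))"
    and "m > 0"
  shows "\<exists>h. fps_nth h 0 = 1 \<and>
    fps_nth c m = fps_X ^ (if odd m then 2 * a * (m - 1) + 1 else 2 * a * m - 3 * a + 3) * h"
proof -
  define x :: "'a fps" where "x = fps_X ^ a"
  define p :: "'a fps" where "p = fps_X ^ (3 * a - 3)"
  define P where "P = 1 + fps_const (1 + x) * fps_X + fps_const x * fps_X ^ 2"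
  define D where "D = Abs_fps (\<lambda>m. f (a * (m + 1)))"
  define N where "N = Abs_fps (\<lambda>m. f (a * m + 1))"
  \<comment> \<open>The rescaling is used in the direction Y = x^2 X, so that no negative powers of
    x arise.\<close>
  define S where "S g = g oo (fps_const (x ^ 2) * fps_X)" for g :: "'a fps fps"
  have S_nth: "fps_nth (S g) m = x ^ (2 * m) * fps_nth g m" for g m
    by (simp add: S_def power_mult)
  have S_mult: "S (g * h) = S g * S h" for g h
    unfolding S_def by (rule fps_compose_mult_distrib) simp
  have x0: "fps_nth x 0 = 0"
    using a by (simp add: x_def)
  have "\<forall>m. \<exists>e. fps_nth (D * P) m = x ^ (2 * m) * ((if m = 0 \<or> m = 2 then 1 else 0) + x * e)"
    unfolding D_def P_def x_def using denominator_window[OF two f a] by blast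
  then obtain e where e: "\<And>m. fps_nth (D * P) m = x ^ (2 * m) * ((if m = 0 \<or> m = 2 then 1 else 0) + x * e m)"
    by metis
  have "\<forall>m. \<exists>r. p * fps_nth (N * P) m = x ^ (2 * m) * r
      \<and> (m = 1 \<longrightarrow> (\<exists>u. r = fps_X ^ (a - 2) * u \<and> fps_nth u 0 = 1))
      \<and> (m = 2 \<longrightarrow> fps_nth r 0 = 1) \<and> (m \<noteq> 1 \<longrightarrow> m \<noteq> 2 \<longrightarrow> x dvd r)"
    unfolding N_def P_def x_def p_def using numerator_window[OF two f a] by blast
  then obtain r where r: "\<And>m. p * fps_nth (N * P) m = x ^ (2 * m) * r m"
      "\<exists>u. r 1 = fps_X ^ (a - 2) * u \<and> fps_nth u 0 = 1"
      "fps_nth (r 2) 0 = 1" "\<And>m. m \<noteq> 1 \<Longrightarrow> m \<noteq> 2 \<Longrightarrow> x dvd r m"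
    by metis
  \<comment> \<open>\<open>\<delta>\<close> and \<open>Abs_fps r\<close> are the cleared denominator
    and numerator in Y, and \<open>\<gamma>\<close> is their quotient; the constant coefficient of
    \<open>\<delta>\<close> is 1 + x e(0), a unit.\<close>
  define \<delta> where "\<delta> = 1 + fps_X ^ 2 + fps_const x * Abs_fps e"
  define \<gamma> where "\<gamma> = Abs_fps r * fps_right_inverse \<delta> (inverse (fps_nth \<delta> 0))"
  have D\<delta>: "D * P = S \<delta>"
    by (rule fps_ext) (auto simp: e S_nth \<delta>_def)
  have N\<nu>: "fps_const p * (N * P) = S (Abs_fps r)"
    by (rule fps_ext) (simp add: r(1) S_nth)
  have \<delta>0: "fps_nth (fps_nth \<delta> 0) 0 = 1"
    by (simp add: \<delta>_def x0)
  then have "fps_nth \<delta> 0 * inverse (fps_nth \<delta> 0) = 1"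
    by (intro inverse_mult_eq_1') simp
  then have "\<delta> * fps_right_inverse \<delta> (inverse (fps_nth \<delta> 0)) = 1"
    by (rule fps_right_inverse)
  then have \<gamma>\<delta>: "\<gamma> * \<delta> = Abs_fps r"
    by (simp add: \<gamma>_def mult.assoc mult.left_commute[of _ \<delta>] mult.commute[of _ \<delta>])
  have "fps_nth (S \<delta>) 0 \<noteq> 0"
    using \<delta>0 by (auto simp: S_nth)
  then have "S \<delta> \<noteq> 0"
    by auto
  \<comment> \<open>The clearing factor \<open>P\<close> multiplies numerator and denominator alike,
    so both sides equal \<open>S (Abs_fps r)\<close>; then the nonzero \<open>S \<delta>\<close>
    cancels.\<close>
  moreover have "(fps_const p * c) * S \<delta> = S \<gamma> * S \<delta>"
  proof -
    have "(fps_const p * c) * S \<delta> = fps_const p * ((c * D) * P)"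
      by (simp add: mult.assoc flip: D\<delta>)
    also have "c * D = N"
      using c by (simp add: D_def N_def)
    finally show ?thesis
      by (simp add: N\<nu> S_mult \<gamma>\<delta>[symmetric])
  qed
  ultimately have "fps_const p * c = S \<gamma>"
    by simp
  then have pc: "p * fps_nth c m = x ^ (2 * m) * fps_nth \<gamma> m" for m
    by (metis S_nth fps_mult_left_const_nth)
  have "\<gamma> + \<gamma> * fps_X * fps_X + fps_const x * (\<gamma> * Abs_fps e) = Abs_fps r"
    unfolding \<gamma>\<delta>[symmetric] \<delta>_def by (simp add: algebra_simps power2_eq_square)
  then have rec: "fps_nth (\<gamma> + \<gamma> * fps_X * fps_X + fps_const x * (\<gamma> * Abs_fps e)) m = r m" for m
    by simp
  have "fps_nth \<gamma> 0 + x * fps_nth (\<gamma> * Abs_fps e) 0 = r 0"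
    using rec[of 0] by simp
  then have "fps_nth \<gamma> 0 = r 0 - x * fps_nth (\<gamma> * Abs_fps e) 0"
    by (simp add: algebra_simps)
  then have \<gamma>_0: "x dvd fps_nth \<gamma> 0"
    by (metis r(4) dvd_diff dvd_triv_left zero_neq_one zero_neq_numeral)
  have "fps_nth \<gamma> 1 + x * fps_nth (\<gamma> * Abs_fps e) 1 = r 1"
    using rec[of 1] by simp
  then have "fps_nth \<gamma> 1 - r 1 = x * - fps_nth (\<gamma> * Abs_fps e) 1"
    by (simp add: algebra_simps)
  then have \<gamma>_1: "x dvd fps_nth \<gamma> 1 - r 1"
    by (rule dvdI)
  \<comment> \<open>Characteristic 2 allows adding the coefficient of index n instead of subtracting
    it, at the price of the last term. This makes the period 2 rather than 4.\<close>
  have \<gamma>_rec: "fps_nth \<gamma> (Suc (Suc n)) - (r (Suc (Suc n)) + fps_nth \<gamma> n)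
      = - x * fps_nth (\<gamma> * Abs_fps e) (Suc (Suc n)) - 2 * fps_nth \<gamma> n" for n
  proof -
    have expanded: "fps_nth \<gamma> (Suc (Suc n)) + fps_nth \<gamma> n + x * fps_nth (\<gamma> * Abs_fps e) (Suc (Suc n)) = r (Suc (Suc n))"
      using rec[of "Suc (Suc n)"] by simp
    then show ?thesis by (simp add: algebra_simps flip: expanded)
  qed
  have \<gamma>_Suc2: "x dvd fps_nth \<gamma> (Suc (Suc n)) - (r (Suc (Suc n)) + fps_nth \<gamma> n)" for n
    unfolding \<gamma>_rec by (simp add: two)
  \<comment> \<open>Induction in steps of two: \<open>r n\<close> vanishes modulo x for n > 2, and
    at n = 2 so does the extra term \<open>fps_nth \<gamma> 0\<close>.\<close>
  have \<gamma>_mod: "x dvd fps_nth \<gamma> n - r (if odd n then 1 else 2)" if "n > 0" for n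
    using that
  proof (induction n rule: less_induct)
    case (less n)
    consider "n = 1" | "n = 2" | "n > 2"
      using less.prems by linarith
    then show ?case
    proof cases
      case 1
      then show ?thesis using \<gamma>_1 by simp
    next
      case 2
      have "x dvd (fps_nth \<gamma> 2 - (r 2 + fps_nth \<gamma> 0)) + fps_nth \<gamma> 0"
        using \<gamma>_Suc2[of 0] \<gamma>_0 by (intro dvd_add) (simp_all add: numeral_2_eq_2)
      then show ?thesis using 2 by (simp add: algebra_simps)
    next
      case 3
      define l where "l = n - 2"
      have l: "l > 0" "n = Suc (Suc l)"
        using 3 by (simp_all add: l_def)
      have "x dvd (fps_nth \<gamma> n - (r n + fps_nth \<gamma> l)) + (fps_nth \<gamma> l - r (if odd l then 1 else 2)) + r n"
        using \<gamma>_Suc2[of l] less.IH[of l] r(4)[of n] l by (intro dvd_add) simp_all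
      then show ?thesis using l by (simp add: algebra_simps)
    qed
  qed
  from \<gamma>_mod[OF \<open>m > 0\<close>] obtain t where t: "fps_nth \<gamma> m = r (if odd m then 1 else 2) + x * t"
    by (metis add.commute diff_eq_eq dvd_def)
  show ?thesis
  proof (cases "odd m")
    case True
    obtain u where u: "r 1 = fps_X ^ (a - 2) * u" "fps_nth u 0 = 1"
      using r(2) by blast
    \<comment> \<open>Since a - 2 < a, the error x t is of higher order than \<open>r 1\<close> and
      leaves its leading coefficient alone.\<close>
    have "x = fps_X ^ (a - 2) * fps_X ^ 2"
      unfolding x_def power_add[symmetric] le_add_diff_inverse2[OF a] ..
    then have "fps_nth \<gamma> m = fps_X ^ (a - 2) * (u + fps_X ^ 2 * t)"
      using t True u(1) by (simp add: algebra_simps)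
    then have "p * fps_nth c m = (x ^ (2 * m) * fps_X ^ (a - 2)) * (u + fps_X ^ 2 * t)"
      by (simp add: pc)
    also have "x ^ (2 * m) * fps_X ^ (a - 2) = p * fps_X ^ (2 * a * (m - 1) + 1)"
    proof -
      obtain l where "m = Suc l"
        using \<open>m > 0\<close> gr0_conv_Suc by blast
      then have "a * (2 * m) + (a - 2) = 3 * a - 3 + (2 * a * (m - 1) + 1)"
        using a by (simp add: algebra_simps)
      then show ?thesis
        unfolding x_def p_def power_mult[symmetric] power_add[symmetric] by simp
    qed
    finally have "p * fps_nth c m = p * (fps_X ^ (2 * a * (m - 1) + 1) * (u + fps_X ^ 2 * t))"
      by (simp only: mult.assoc)
    then have "fps_nth c m = fps_X ^ (2 * a * (m - 1) + 1) * (u + fps_X ^ 2 * t)"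
      unfolding p_def by (subst (asm) mult_left_cancel) simp_all
    then show ?thesis
      using True u(2) by (intro exI[of _ "u + fps_X ^ 2 * t"]) simp
  next
    case False
    have "x ^ (2 * m) = p * fps_X ^ (2 * a * m - 3 * a + 3)"
    proof -
      \<comment> \<open>An even positive m is at least 2, so the natural subtraction 2am - 3a is not
        truncated.\<close>
      define l where "l = m - 2"
      have "m = Suc (Suc l)"
        using \<open>m > 0\<close> False by (cases "m = 1") (auto simp: l_def)
      then have "a * (2 * m) = 3 * a - 3 + (2 * a * m - 3 * a + 3)"
        using a by (simp add: algebra_simps)
      then show ?thesis
        unfolding x_def p_def power_mult[symmetric] power_add[symmetric] by simp
    qed
    then have "p * fps_nth c m = p * (fps_X ^ (2 * a * m - 3 * a + 3) * fps_nth \<gamma> m)"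
      by (simp only: pc mult.assoc)
    then have "fps_nth c m = fps_X ^ (2 * a * m - 3 * a + 3) * fps_nth \<gamma> m"
      unfolding p_def by (subst (asm) mult_left_cancel) simp_all
    moreover have "fps_nth (fps_nth \<gamma> m) 0 = 1"
      using t False r(3) by (simp add: x0)
    ultimately show ?thesis
      using False by auto
  qed
qed

section \<open>Expansion of Phi and F up to order four\<close>

lemma fps_eq_X_power_mult:
  fixes f :: "'a :: comm_ring_1 fps"
  assumes "\<And>j. j < n \<Longrightarrow> fps_nth f j = 0"
  shows "f = fps_X ^ n * Abs_fps (\<lambda>j. fps_nth f (n + j))"
  using assms by (intro fps_ext) (auto simp: fps_X_power_mult_nth)

text \<open>The first three factors already multiply to 1 - q - q^2 + O(q^4), and every later one is
  1 + O(q^4). The factors of \<open>P n\<close> have exponents up to n + 1, so these three make up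
  \<open>P 2\<close>.\<close>

lemma Phi_low_order: "\<exists>g. Phi = 1 - fps_X - fps_X ^ 2 + fps_X ^ 4 * g"
proof -
  define P :: "nat \<Rightarrow> int fps" where "P n = (\<Prod>i\<le>n. 1 - fps_X ^ Suc i)" for n
  have nz: "1 - fps_X ^ Suc i \<noteq> (0 :: int fps)" for i
  proof
    assume "1 - fps_X ^ Suc i = (0 :: int fps)"
    then have "fps_nth (1 - fps_X ^ Suc i :: int fps) 0 = 0"
      by (simp only: fps_zero_nth)
    then show False by simp
  qed
  have "P \<longlonglongrightarrow> Phi"
    using Phi_has_prod nz unfolding has_prod_def raw_has_prod_def P_def by auto
  then have lim: "\<forall>\<^sub>F n in sequentially. fps_nth (P n) j = fps_nth Phi j" for j
    by (simp add: tendsto_fps_iff)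
  have P_low: "\<exists>g. P n = 1 - fps_X - fps_X ^ 2 + fps_X ^ 4 * g" if "n \<ge> 2" for n
    using that
  proof (induction n rule: dec_induct)
    case base
    define q :: "int fps" where "q = fps_X"
    have "P 2 = (1 - q) * (1 - q ^ 2) * (1 - q ^ 3)"
      by (simp add: P_def numeral_2_eq_2 numeral_3_eq_3 flip: q_def)
    also have "\<dots> = 1 - q - q ^ 2 + q ^ 4 * (1 + q - q ^ 2)"
      by algebra
    finally show ?case
      unfolding q_def by blast
  next
    case (step n)
    then obtain g where g: "P n = 1 - fps_X - fps_X ^ 2 + fps_X ^ 4 * g"
      by blast
    have X: "fps_X ^ Suc (Suc n) = (fps_X :: int fps) ^ 4 * fps_X ^ (n - 2)"
      unfolding power_add[symmetric] using step.hyps by simp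
    have "P (Suc n) = P n - P n * (fps_X ^ 4 * fps_X ^ (n - 2))"
      unfolding X[symmetric] by (simp add: P_def right_diff_distrib)
    also have "\<dots> = 1 - fps_X - fps_X ^ 2 + fps_X ^ 4 * (g - P n * fps_X ^ (n - 2))"
      unfolding right_diff_distrib by (subst (1) g) (simp only: algebra_simps)
    finally show ?case by blast
  qed
  have coeff: "fps_nth (P n) j = fps_nth (1 - fps_X - fps_X ^ 2) j" if "n \<ge> 2" "j < 4" for n j
  proof -
    obtain g where "P n = 1 - fps_X - fps_X ^ 2 + fps_X ^ 4 * g"
      using P_low[OF \<open>n \<ge> 2\<close>] ..
    then show ?thesis
      using \<open>j < 4\<close> by (simp add: fps_X_power_mult_nth)
  qed
  have "fps_nth Phi j = fps_nth (1 - fps_X - fps_X ^ 2) j" if "j < 4" for j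
  proof -
    have "\<forall>\<^sub>F n in sequentially. n \<ge> 2 \<and> fps_nth (P n) j = fps_nth Phi j"
      using eventually_ge_at_top[of 2] lim by (rule eventually_conj)
    then obtain n where "n \<ge> 2" "fps_nth (P n) j = fps_nth Phi j"
      by (auto dest: eventually_happens)
    then show ?thesis
      using coeff that by metis
  qed
  then have "Phi - (1 - fps_X - fps_X ^ 2)
      = fps_X ^ 4 * Abs_fps (\<lambda>j. fps_nth (Phi - (1 - fps_X - fps_X ^ 2)) (4 + j))"
    by (intro fps_eq_X_power_mult) simp
  then show ?thesis
    unfolding diff_eq_eq add.commute[of _ "1 - fps_X - fps_X ^ 2"] ..
qed

text \<open>The two values of \<open>k\<close> agree here because Phi^4 is congruent to Phi(q^4) = 1
  + O(q^4) modulo 2; the proof expands each case directly.\<close>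

lemma F_mod2:
  assumes "k = 3 \<or> k = -1"
  shows "\<exists>G H. F k = 1 + fps_X + fps_X ^ 3 + fps_X ^ 4 * G + 2 * H"
proof -
  define q :: "int fps" where "q = fps_X"
  obtain g where g: "Phi = 1 - q - q ^ 2 + q ^ 4 * g"
    using Phi_low_order unfolding q_def ..
  have "\<exists>G H. F k = 1 + q + q ^ 3 + q ^ 4 * G + 2 * H"
    using assms
  proof
    assume k: "k = 3"
    define v where "v = 1 - q - q ^ 2"
    have "F k = (v + q ^ 4 * g) ^ 3"
      by (simp add: F_def ipow_def k g v_def)
    also have "\<dots> = v ^ 3 + q ^ 4 * ((3 * v ^ 2 + 3 * v * q ^ 4 * g + q ^ 8 * g ^ 2) * g)"
      by algebra
    also have "v ^ 3 = 1 + q + q ^ 3 + q ^ 4 * (- 3 * q - q ^ 2) + 2 * (2 * q ^ 3 - 2 * q)"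
      unfolding v_def by algebra
    finally have "F k = 1 + q + q ^ 3
        + q ^ 4 * (- 3 * q - q ^ 2 + (3 * v ^ 2 + 3 * v * q ^ 4 * g + q ^ 8 * g ^ 2) * g)
        + 2 * (2 * q ^ 3 - 2 * q)"
      by (simp only: distrib_left add_ac)
    then show ?thesis by blast
  next
    assume k: "k = -1"
    have "F k = recip1 Phi"
      by (simp add: F_def ipow_def k)
    then have "Phi * F k = 1"
      by (simp add: recip1_right Phi_nth_0)
    \<comment> \<open>Modulo 2 and q^4 the factor 1 + q + q^3 inverts 1 - q - q^2: their product is
      1 - 2 q^2 - q^4 - q^5. The last summand, zero because \<open>Phi * F k = 1\<close>, turns the
      claim into a polynomial identity.\<close>
    moreover have "F k = 1 + q + q ^ 3 + q ^ 4 * ((1 + q - (1 + q + q ^ 3) * g) * F k)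
        + 2 * (q ^ 2 * F k) + (1 + q + q ^ 3) * (Phi * F k - 1)"
      unfolding g by algebra
    ultimately show ?thesis by auto
  qed
  then show ?thesis
    by (simp only: q_def)
qed

section \<open>Substitution of powers of q and reduction modulo two\<close>

lemma subst_pow_one: "subst_pow f (Suc 0) = f"
  by (simp add: subst_pow_def)

lemma subst_pow_add: "subst_pow (f + g) n = subst_pow f n + subst_pow g n"
  by (simp add: subst_pow_def fps_compose_add_distrib)

lemma subst_pow_mult: "n > 0 \<Longrightarrow> subst_pow (f * g) n = subst_pow f n * subst_pow g n"
  by (simp add: subst_pow_def fps_compose_mult_distrib)

lemma subst_pow_1: "subst_pow 1 n = 1"
  by (simp add: subst_pow_def)

lemma subst_pow_X_power: "n > 0 \<Longrightarrow> subst_pow (fps_X ^ i) n = fps_X ^ (i * n)"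
  by (simp add: subst_pow_def fps_X_power_compose mult.commute flip: power_mult)

lemma subst_pow_power: "n > 0 \<Longrightarrow> subst_pow (f ^ i) n = subst_pow f n ^ i"
  by (induction i) (simp_all add: subst_pow_1 subst_pow_mult)

lemma subst_pow_recip1:
  assumes "n > 0" "fps_nth f 0 = 1"
  shows "subst_pow (recip1 f) n = recip1 (subst_pow f n)"
proof -
  have "subst_pow f n * subst_pow (recip1 f) n = 1"
    using assms by (simp add: recip1_right subst_pow_1 flip: subst_pow_mult)
  moreover have "subst_pow f n * recip1 (subst_pow f n) = 1"
    using assms by (simp add: recip1_right subst_pow_nth_0)
  ultimately have "subst_pow f n * subst_pow (recip1 f) n = subst_pow f n * recip1 (subst_pow f n)"
    by simp
  moreover have "subst_pow f n \<noteq> 0"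
    using assms(2) subst_pow_nth_0[of f n] by auto
  ultimately show ?thesis
    by simp
qed

lemma subst_pow_ipow:
  assumes "n > 0" "fps_nth f 0 = 1"
  shows "subst_pow (ipow f k) n = ipow (subst_pow f n) k"
  using assms by (simp add: ipow_def subst_pow_power subst_pow_recip1)

text \<open>Applied at \<open>bit fps\<close>, where \<open>bit\<close> is the field with two
  elements, this is reduction modulo 2.\<close>

definition fps_of_int_fps :: "int fps \<Rightarrow> 'a :: comm_ring_1 fps" where
  "fps_of_int_fps f = Abs_fps (\<lambda>n. of_int (fps_nth f n))"

lemma fps_of_int_fps_nth [simp]: "fps_nth (fps_of_int_fps f) n = of_int (fps_nth f n)"
  by (simp add: fps_of_int_fps_def)

lemma fps_of_int_fps_add: "fps_of_int_fps (f + g) = fps_of_int_fps f + fps_of_int_fps g"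
  by (rule fps_ext) simp

lemma fps_of_int_fps_mult: "fps_of_int_fps (f * g) = fps_of_int_fps f * fps_of_int_fps g"
  by (rule fps_ext) (simp add: fps_mult_nth)

lemma fps_of_int_fps_sum: "fps_of_int_fps (sum f A) = (\<Sum>i\<in>A. fps_of_int_fps (f i))"
  by (rule fps_ext) (simp add: fps_sum_nth)

lemma fps_of_int_fps_1: "fps_of_int_fps 1 = 1"
  by (rule fps_ext) simp

lemma fps_of_int_fps_X_power: "fps_of_int_fps (fps_X ^ n) = fps_X ^ n"
  by (rule fps_ext) simp

lemma two_bit_fps: "(2 :: bit fps) = 0"
  by (rule fps_ext) (simp add: numeral_fps_const)

text \<open>The product form \<open>Cgen_times_Cden\<close> is reduced modulo 2 one coefficient of X
  at a time, so no inverse has to be reduced.\<close>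

lemma C_mod2:
  assumes k: "k = 3 \<or> k = -1" and a: "a \<ge> 2" and m: "m > 0"
  shows "\<exists>h :: bit fps. fps_nth h 0 = 1 \<and> fps_of_int_fps (C a k m)
    = fps_X ^ (if odd m then 2 * a * (m - 1) + 1 else 2 * a * m - 3 * a + 3) * h"
proof -
  define c :: "bit fps fps" where "c = Abs_fps (\<lambda>m. fps_of_int_fps (C a k m))"
  define f :: "nat \<Rightarrow> bit fps" where "f s = fps_of_int_fps (subst_pow (F k) s)" for s
  obtain G H where "F k = 1 + fps_X + fps_X ^ 3 + fps_X ^ 4 * G + 2 * H"
    using F_mod2[OF k] by blast
  then have GH: "F k = 1 + fps_X ^ 1 + fps_X ^ 3 + fps_X ^ 4 * G + 2 * H"
    by (simp only: power_one_right)
  have f: "f s = 1 + fps_X ^ s + fps_X ^ (3 * s) + fps_X ^ (4 * s) * fps_of_int_fps (subst_pow G s)"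
    if "s > 0" for s
  proof -
    have "fps_of_int_fps (subst_pow (2 * H) s) = (2 :: bit fps) * fps_of_int_fps (subst_pow H s)"
      unfolding mult_2 subst_pow_add fps_of_int_fps_add ..
    also have "\<dots> = 0"
      by (simp only: two_bit_fps mult_zero_left)
    finally show ?thesis
      unfolding f_def GH subst_pow_add fps_of_int_fps_add
      using that by (simp only: subst_pow_mult subst_pow_X_power subst_pow_1 fps_of_int_fps_mult
          fps_of_int_fps_X_power fps_of_int_fps_1 mult_1 add_0_right)
  qed
  have "c * Abs_fps (\<lambda>m. f (a * (m + 1))) = Abs_fps (\<lambda>m. f (a * m + 1))"
  proof (rule fps_ext)
    fix m
    have "fps_nth (Cnum a k) m = fps_nth (Cgen a k * Cden a k) m"
      by (simp add: Cgen_times_Cden)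
    then have "subst_pow (F k) (a * m + 1) = (\<Sum>i=0..m. C a k i * subst_pow (F k) (a * (m - i + 1)))"
      by (simp add: fps_mult_nth Cnum_def Cden_def C_def)
    from arg_cong[OF this[symmetric], of fps_of_int_fps]
    show "fps_nth (c * Abs_fps (\<lambda>m. f (a * (m + 1)))) m = fps_nth (Abs_fps (\<lambda>m. f (a * m + 1))) m"
      by (simp add: fps_mult_nth c_def f_def fps_of_int_fps_sum fps_of_int_fps_mult del: mult_bit_eq_and add_bit_eq_xor)
  qed
  from char2_quotient_coefficient[OF two_bit_fps f a this m] show ?thesis
    by (simp only: c_def fps_nth_Abs_fps)
qed

section \<open>The difference of W and T\<close>

text \<open>Identifies the summand j = 0 of \<open>W\<close> with \<open>T\<close>.\<close>

lemma C_0: "a > 0 \<Longrightarrow> C a k 0 = ipow Phi k * recip1 (ipow (subst_pow Phi a) k)"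
  by (simp add: C_def Cgen_def Cnum_def F_def subst_pow_ipow Phi_nth_0 subst_pow_one)

lemma fls_nth_X_intpow_mult_fps_to_fls:
  fixes f :: "'a :: comm_ring_1 fps"
  shows "fls_nth (fls_X_intpow i * fps_to_fls f) n = (if n < i then 0 else fps_nth f (nat (n - i)))"
  by (subst fls_X_intpow_times_conv_shift) simp

text \<open>The summand j = 0 cancels against \<open>T\<close>. The factor q^(ajd) has order at
  least j, so summands with j > i do not reach q^i, and any cut-off \<open>M\<close> beyond i gives
  the same sum.\<close>

lemma W_minus_T_nth:
  assumes "a > 0" "d > 0" "M > i"
  shows "fls_nth (W a d k - T a k) (1 - int a + int i)
    = (\<Sum>j=1..<Suc M. fps_nth (C a k (j * d) * fps_X ^ (a * j * d)) i)"
proof -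
  let ?t = "\<lambda>j. C a k (j * d) * fps_X ^ (a * j * d)"
  have "?t sums suminf ?t"
    using W_summable[of a d k] assms by (simp add: summable_sums)
  then have "\<forall>\<^sub>F n in sequentially. fps_nth (\<Sum>j<n. ?t j) i = fps_nth (suminf ?t) i"
    by (simp add: sums_def tendsto_fps_iff)
  then obtain n0 where n0: "\<And>n. n \<ge> n0 \<Longrightarrow> fps_nth (\<Sum>j<n. ?t j) i = fps_nth (suminf ?t) i"
    by (auto simp: eventually_sequentially)
  have tail: "fps_nth (?t j) i = 0" if "j > i" for j
  proof -
    have "1 * j * 1 \<le> a * j * d"
      using assms by (intro mult_le_mono) auto
    with that have "i < a * j * d" by linarith
    then show ?thesis by (simp add: fps_X_power_mult_right_nth)
  qed
  \<comment> \<open>Far enough both for the partial sums to have stabilised at i and for the cut-off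
    to be covered.\<close>
  define n where "n = max n0 (Suc M)"
  have "fps_nth (suminf ?t) i = (\<Sum>j<n. fps_nth (?t j) i)"
    using n0[of n] by (simp add: n_def fps_sum_nth)
  also have "\<dots> = (\<Sum>j<Suc M. fps_nth (?t j) i)"
    using tail assms(3) by (intro sum.mono_neutral_right) (auto simp: n_def)
  also have "\<dots> = fps_nth (C a k 0) i + (\<Sum>j=1..<Suc M. fps_nth (?t j) i)"
    unfolding lessThan_atLeast0 by (subst sum.atLeast_Suc_lessThan) simp_all
  finally show ?thesis
    using assms(1) unfolding W_def T_def fls_minus_nth fls_nth_X_intpow_mult_fps_to_fls
    by (simp add: C_0)
qed

lemma W_minus_T_nth_eq_0: "n < 1 - int a \<Longrightarrow> fls_nth (W a d k - T a k) n = 0"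
  unfolding W_def T_def fls_minus_nth fls_nth_X_intpow_mult_fps_to_fls by simp

text \<open>Modulo 2 and apart from the prefactor q^(1-a), the summand j has exact order
  \<open>e (j * d)\<close>. This is smallest for j = 1, so \<open>N\<close> is \<open>e d\<close>
  shifted by 1 - a.\<close>

lemma leading_coefficient_mod2:
  fixes k :: int and a d :: nat
  assumes k: "k = 3 \<or> k = -1" and a: "a \<ge> 2" and d: "d \<ge> 2"
  defines "N \<equiv> if odd d then 3 * int a * (int d - 1) + 2 else int a * (3 * int d - 4) + 4"
  shows "n < N \<Longrightarrow> even (fls_nth (W a d k - T a k) n)"
    and "odd (fls_nth (W a d k - T a k) N)"
proof -
  define v where "v m = (if odd m then 2 * a * (m - 1) + 1 else 2 * a * m - 3 * a + 3)" for m
  have "\<forall>m\<in>{0<..}. \<exists>h :: bit fps. fps_nth h 0 = 1 \<and> fps_of_int_fps (C a k m) = fps_X ^ v m * h"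
    using C_mod2[OF k a] by (auto simp: v_def)
  then obtain h :: "nat \<Rightarrow> bit fps" where h: "\<And>m. m > 0 \<Longrightarrow> fps_nth (h m) 0 = 1"
      "\<And>m. m > 0 \<Longrightarrow> fps_of_int_fps (C a k m) = fps_X ^ v m * h m"
    by (auto simp: bchoice_iff)
  define e where "e m = a * m + v m" for m
  have e_ge: "int (e m) \<ge> 3 * int a * int m - 3 * int a + 1"
    and e_odd: "odd m \<Longrightarrow> int (e m) = 3 * int a * int m - 2 * int a + 1"
    and e_even: "even m \<Longrightarrow> int (e m) = 3 * int a * int m - 3 * int a + 3" if "m > 0" for m
  proof -
    have ev: "int (2 * a * m - 3 * a + 3) = 2 * int a * int m + 3 - 3 * int a" if "even m"
    proof -
      have "m \<ge> 2" using that \<open>m > 0\<close> by (auto elim!: evenE)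
      then have "2 * a * 2 \<le> 2 * a * m" by (intro mult_le_mono) auto
      then have "int (2 * a * m - 3 * a + 3) = int (2 * a * m) + 3 - int (3 * a)" by linarith
      then show ?thesis by simp
    qed
    show *: "odd m \<Longrightarrow> int (e m) = 3 * int a * int m - 2 * int a + 1"
      using that by (cases m) (simp_all add: e_def v_def algebra_simps)
    show **: "even m \<Longrightarrow> int (e m) = 3 * int a * int m - 3 * int a + 3"
      using ev by (simp add: e_def v_def algebra_simps)
    show "int (e m) \<ge> 3 * int a * int m - 3 * int a + 1"
      using * ** by (cases "even m") auto
  qed
  have N: "N = 1 - int a + int (e d)"
    using e_odd[of d] e_even[of d] d by (simp add: N_def algebra_simps)
  have C_coeff: "(of_int (fps_nth (C a k m * fps_X ^ (a * m)) i) :: bit) = (if i < e m then 0 else fps_nth (h m) (i - e m))"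
    if "m > 0" for m i
  proof -
    have "of_int (fps_nth (C a k m * fps_X ^ (a * m)) i)
        = fps_nth (fps_of_int_fps (C a k m * fps_X ^ (a * m)) :: bit fps) i"
      by simp
    also have "fps_of_int_fps (C a k m * fps_X ^ (a * m)) = fps_X ^ e m * h m"
      using h(2)[OF that] by (simp add: fps_of_int_fps_mult fps_of_int_fps_X_power e_def power_add mult_ac)
    finally show ?thesis
      by (simp add: fps_X_power_mult_nth)
  qed
  \<comment> \<open>As d >= 2, jd >= d + 2. The lower bound \<open>e_ge\<close>, valid for both
    parities, gives e(jd) >= 3ad + 3a + 1, while e(d) <= 3ad - 2a + 1; for even d the latter rests
    on a >= 2.\<close>
  have e_less: "e d < e (j * d)" if "j \<ge> 2" for j
  proof -
    have "d + 2 \<le> j * d"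
      using mult_le_mono1[OF that, of d] d by linarith
    then have "int d + 2 \<le> int (j * d)"
      by linarith
    then have "3 * int a * (int d + 2) \<le> 3 * int a * int (j * d)"
      by (rule mult_left_mono) simp
    moreover have "int (e d) \<le> 3 * int a * int d - 2 * int a + 1"
      using e_odd[of d] e_even[of d] a d by (cases "even d") auto
    ultimately show ?thesis
      using e_ge[of "j * d"] that d a by (simp add: algebra_simps)
  qed
  have coeff: "(of_int (fls_nth (W a d k - T a k) (1 - int a + int i)) :: bit) = of_bool (i = e d)" if "i \<le> e d" for i
  proof -
    \<comment> \<open>The cut-off \<open>Suc i\<close> keeps j = 1 in the range even for i = 0, so
      that it can be split off at the end.\<close>
    have "(of_int (fls_nth (W a d k - T a k) (1 - int a + int i)) :: bit)
        = (\<Sum>j=1..<Suc (Suc i). of_int (fps_nth (C a k (j * d) * fps_X ^ (a * (j * d))) i))"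
      using a d by (subst W_minus_T_nth[of _ _ _ "Suc i"]) (simp_all add: mult.assoc del: add_bit_eq_xor mult_bit_eq_and)
    also have "\<dots> = (\<Sum>j=1..<Suc (Suc i). of_bool (j = 1 \<and> i = e d))"
    proof (rule sum.cong[OF refl])
      fix j assume "j \<in> {1..<Suc (Suc i)}"
      then have j: "j \<ge> 1" by simp
      have "(if i < e (j * d) then 0 else fps_nth (h (j * d)) (i - e (j * d))) = of_bool (j = 1 \<and> i = e d)"
      proof (cases "j = 1")
        case True
        then show ?thesis using that h(1)[of d] d by auto
      next
        case False
        then show ?thesis using e_less[of j] that j by auto
      qed
      then show "(of_int (fps_nth (C a k (j * d) * fps_X ^ (a * (j * d))) i) :: bit) = of_bool (j = 1 \<and> i = e d)"
        using j d by (subst C_coeff) simp_all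
    qed
    also have "\<dots> = of_bool (i = e d)"
      by (subst sum.atLeast_Suc_lessThan) (simp_all del: sum.op_ivl_Suc)
    finally show ?thesis .
  qed
  have even_iff: "even z \<longleftrightarrow> (of_int z :: bit) = 0" for z :: int
    by (metis even_of_int_iff even_zero bit_not_zero_iff odd_one)
  show "odd (fls_nth (W a d k - T a k) N)"
    unfolding N even_iff by (simp add: coeff del: fls_minus_nth)
  show "even (fls_nth (W a d k - T a k) n)" if "n < N"
  proof (cases "n < 1 - int a")
    case True
    then show ?thesis by (simp add: W_minus_T_nth_eq_0 del: fls_minus_nth)
  next
    case False
    define i where "i = nat (n - (1 - int a))"
    have "n = 1 - int a + int i" "i < e d"
      using False that by (auto simp: i_def N)
    then show ?thesis
      unfolding even_iff using coeff[of i] by (simp del: fls_minus_nth)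
  qed
qed

theorem corollary2p14:
  fixes k :: int and a d :: nat
  assumes "k = 3 \<or> k = -1" and "a \<ge> 2" and "d \<ge> 2"
  shows "(let N = (if odd d then 3 * int a * (int d - 1) + 2 else int a * (3 * int d - 4) + 4)
          in (\<forall>n<N. [fls_nth (W a d k - T a k) n = 0] (mod 2)) \<and>
             [fls_nth (W a d k - T a k) N = 1] (mod 2))
       \<and> (\<exists>R. bigO_q (6 * int d - 3) R \<and>
             cong_mod2 (W 2 d k - T 2 k) (fls_X_intpow (6 * int d - 4) + R))"
proof
  show "let N = (if odd d then 3 * int a * (int d - 1) + 2 else int a * (3 * int d - 4) + 4)
    in (\<forall>n<N. [fls_nth (W a d k - T a k) n = 0] (mod 2)) \<and> [fls_nth (W a d k - T a k) N = 1] (mod 2)"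
    using leading_coefficient_mod2[OF assms]
    by (simp add: Let_def cong_def mod2_eq_if del: fls_minus_nth)
  define U where "U = W 2 d k - T 2 k"
  \<comment> \<open>\<open>R\<close> is \<open>U\<close> cut off below the order 6d - 3, shifted so
    that the cofactor is a power series.\<close>
  define R where "R = fls_X_intpow (6 * int d - 3)
    * fps_to_fls (Abs_fps (\<lambda>n. fls_nth U (6 * int d - 3 + int n)))"
  \<comment> \<open>At a = 2 the two parity cases coincide.\<close>
  have N: "(if odd d then 3 * int 2 * (int d - 1) + 2 else int 2 * (3 * int d - 4) + 4) = 6 * int d - 4"
    by simp
  have U: "n < 6 * int d - 4 \<Longrightarrow> even (fls_nth U n)" "odd (fls_nth U (6 * int d - 4))" for n
    using leading_coefficient_mod2[OF assms(1) order.refl assms(3)] unfolding N U_def by auto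
  have R: "fls_nth R n = (if n < 6 * int d - 3 then 0 else fls_nth U n)" for n
    unfolding R_def fls_nth_X_intpow_mult_fps_to_fls by simp
  have "[fls_nth U n = fls_nth (fls_X_intpow (6 * int d - 4) + R) n] (mod 2)" for n
  proof -
    consider "n < 6 * int d - 4" | "n = 6 * int d - 4" | "n \<ge> 6 * int d - 3"
      by linarith
    then show ?thesis
      using U by cases (auto simp: R cong_def mod2_eq_if)
  qed
  then show "\<exists>R. bigO_q (6 * int d - 3) R \<and>
      cong_mod2 (W 2 d k - T 2 k) (fls_X_intpow (6 * int d - 4) + R)"
    unfolding cong_mod2_def bigO_q_def U_def[symmetric] using R_def by blast
qed

end
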